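(* There exist a Lipschitz continuous function $f\colon\mathbb{R}^4\to\mathbb{R}$, a map $G\colon\mathbb{R}^4\to\mathbb{R}^4$ with $G(X)\in\partial f(X)$ for every $X\in\mathbb{R}^4$, and a point $\bar X\in\mathbb{R}^4$ such that for every sequence $\{t_n\}_{n\ge1}\subset(0,+\infty)$ with $$\sum_{n\ge1}t_n=+\infty\qquad\text{and}\qquad\sum_{n\ge1}t_n^2<+\infty,$$ the sequence $\{X_n\}_{n\ge1}$ defined by $$X_1=\bar X,\qquad X_{n+1}=X_n-t_n\,G(X_n)\quad(n\ge1)$$ is bounded and none of its accumulation points belongs to $\mathrm{Crit}(f)$.
   Context: For a (locally) Lipschitz function $f\colon\mathcal{U}\to\mathbb{R}$ on an open set $\mathcal{U}\subset\mathbb{R}^d$, let $\mathcal{D}_f\subset\mathcal{U}$ be the set of points where $f$ is differentiable (it has full Lebesgue measure in $\mathcal{U}$ by Rademacher's theorem). The Clarke subdifferential of $f$ at $x\in\mathcal{U}$ is $$\partial f(x):=\mathrm{conv}\Big\{\lim_{k\to\infty}\nabla f(x_k):\ x_k\to x,\ \{x_k\}\subset\mathcal{D}_f\Big\},$$ where only sequences for which the limit exists are considered and $\mathrm{conv}$ denotes the convex hull. A point $x$ is (Clarke) critical for $f$ if $0\in\partial f(x)$; $\mathrm{Crit}(f)$ denotes the set of all critical points of $f$. *)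

theory Defs
  imports "HOL-Analysis.Analysis"
begin

text \<open>In the next definition \<open>x\<close> is meant to lie in the open set \<open>U\<close>, on which \<open>f\<close> is locally
  Lipschitz. On a Euclidean space, \<open>GDERIV f y :> g\<close> says that \<open>f\<close> is (Frechet) differentiable
  at \<open>y\<close> and that \<open>g\<close> is its gradient there, so \<open>xs\<close> ranges over sequences of points of
  differentiability and \<open>gs\<close> is the sequence of gradients.\<close>

definition clarke_subdifferential ::
    "'a::euclidean_space set \<Rightarrow> ('a \<Rightarrow> real) \<Rightarrow> 'a \<Rightarrow> 'a set"
  where "clarke_subdifferential U f x =
    convex hull {v. \<exists>xs gs. (\<forall>k::nat. xs k \<in> U \<and> GDERIV f (xs k) :> gs k) \<and>
                            xs \<longlonglongrightarrow> x \<and> gs \<longlonglongrightarrow> v}"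

definition clarke_critical :: "'a::euclidean_space set \<Rightarrow> ('a \<Rightarrow> real) \<Rightarrow> 'a set"
  where "clarke_critical U f = {x \<in> U. 0 \<in> clarke_subdifferential U f x}"

text \<open>Accumulation points of a sequence are its subsequential limits. This differs from the limit
  points (\<open>islimpt\<close>) of its range: an eventually constant sequence accumulates at its final value.\<close>

definition accumulation_point :: "(nat \<Rightarrow> 'a::topological_space) \<Rightarrow> 'a \<Rightarrow> bool"
  where "accumulation_point X x \<longleftrightarrow> (\<exists>r. strict_mono r \<and> (X \<circ> r) \<longlonglongrightarrow> x)"

end

theory Submission
  imports Defs
begin

text \<open>Let \<open>\<xi>\<close> be Lipschitz, \<open>2\<pi>\<close>-periodic and of slope \<open>-1\<close> on a dense open set (a devil's staircase
  built on a fat Cantor set, minus the identity), and let \<open>f = z + min 1 r * \<xi>(z - \<theta>)\<close>, where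
  \<open>r, \<theta>\<close> are polar coordinates in the \<open>(x, y)\<close>-plane. Moving along the helix
  \<open>(\<theta> + t, z + t)\<close> increases \<open>f\<close> by exactly \<open>t\<close>, so every gradient, and hence every Clarke
  subgradient, has inner product \<open>1\<close> with \<open>(-y, x, 1, 0)\<close>: there are no critical points. On the
  other hand, for \<open>r > 1\<close> the function agrees locally with \<open>\<theta>\<close> plus a constant on a dense open
  set, so \<open>\<nabla>\<theta> = (-y, x, 0, 0) / r\<^sup>2\<close> is a subgradient. The subgradient method that selects it
  circles around the \<open>z\<close>-axis, and \<open>r\<^sup>2\<close> grows by \<open>t\<^sub>n\<^sup>2 / r\<^sup>2 \<le> t\<^sub>n\<^sup>2\<close> in each step.\<close>

section \<open>A periodic Lipschitz function of slope -1 on a dense open set\<close>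

lemma devil_staircase:
  obtains \<phi> :: "real \<Rightarrow> real" and L :: real
  where "\<phi> 0 = 0" "\<phi> 1 = 1" "L-lipschitz_on UNIV \<phi>"
    "\<And>a b. 0 \<le> a \<Longrightarrow> a < b \<Longrightarrow> b \<le> 1 \<Longrightarrow> \<exists>s\<in>{a<..<b}. \<forall>\<^sub>F t in nhds s. \<phi> t = \<phi> s"
proof -
  have null: "\<rat> \<in> null_sets (lebesgue :: real measure)"
    by (intro null_sets_completionI countable_imp_null_set_lborel countable_rat)
  then have "(\<rat> :: real set) \<in> sets lebesgue"
    by blast
  \<comment> \<open>Outer regularity of the null set of rationals: \<open>U\<close> is open and
    dense but has measure below 1, so \<open>{0..1} - U\<close> is a fat Cantor set.\<close>
  then obtain U :: "real set" where U: "open U" "\<rat> \<subseteq> U" "U - \<rat> \<in> lmeasurable"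
      "emeasure lebesgue (U - \<rat>) < ennreal 1"
    using sets_lebesgue_outer_open[of \<rat> 1] by (metis zero_less_one)
  have Ulm: "U \<in> lmeasurable" and Um: "measure lebesgue U < 1"
  proof -
    have eq: "U = (U - \<rat>) \<union> \<rat>"
      using U(2) by auto
    have rlm: "(\<rat> :: real set) \<in> lmeasurable"
      using null negligible_iff_null_sets negligible_iff_measure by blast
    show "U \<in> lmeasurable"
      using U(3) rlm eq fmeasurable.Un by metis
    have "measure lebesgue U = measure lebesgue (U - \<rat>)"
      using measure_Diff_null_set[OF fmeasurableD[OF \<open>U \<in> lmeasurable\<close>] null] by simp
    also have "\<dots> < 1"
      using U(3,4) by (simp add: emeasure_eq_measure2 ennreal_less_iff)
    finally show "measure lebesgue U < 1" .
  qed
  \<comment> \<open>The unnormalised staircase measures the part of the Cantor set to the left of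
    \<open>s\<close>. It is constant on every interval inside \<open>U\<close>, hence near every
    rational, and it rises because the Cantor set has positive measure.\<close>
  define F where "F = (\<lambda>s. measure lebesgue ({0..s} - U))"
  have lm: "{0..s} - U \<in> lmeasurable" for s
    using Ulm by (intro fmeasurable_Diff) auto
  \<comment> \<open>The increment is a difference of intervals starting at 0, and not the measure of
    \<open>{s<..t} - U\<close>, so that it is also correct for negative \<open>s\<close>, where
    \<open>{0..s}\<close> is empty.\<close>
  have step: "F t - F s = measure lebesgue ({0..t} - {0..s} - U)" if "s \<le> t" for s t
  proof -
    have "F t = measure lebesgue (({0..s} - U) \<union> ({0..t} - U))"
      unfolding F_def using that by (intro arg_cong[where f = "measure lebesgue"]) auto
    also have "\<dots> = F s + measure lebesgue (({0..t} - U) - ({0..s} - U))"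
      unfolding F_def by (rule measure_Un2[OF lm lm])
    also have "({0..t} - U) - ({0..s} - U) = {0..t} - {0..s} - U"
      by auto
    finally show ?thesis
      by simp
  qed
  have mono: "F s \<le> F t" if "s \<le> t" for s t
    using step[OF that] measure_nonneg[of lebesgue "{0..t} - {0..s} - U"] by linarith
  have lip: "F t - F s \<le> t - s" if "s \<le> t" for s t
  proof -
    have "F t - F s \<le> measure lebesgue {s..t}"
      unfolding step[OF that] using Ulm
      by (intro measure_mono_fmeasurable) (auto intro!: sets.Diff fmeasurableD)
    then show ?thesis
      using that by simp
  qed
  have F0: "F 0 = 0"
    using subsetD[OF U(2) Rats_0] by (simp add: F_def)
  have F1: "F 1 > 0"
  proof -
    have "1 = measure lebesgue {0..1::real}"
      by simp
    also have "\<dots> \<le> measure lebesgue (({0..1} - U) \<union> U)"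
      using lm Ulm by (intro measure_mono_fmeasurable) auto
    also have "\<dots> \<le> F 1 + measure lebesgue U"
      unfolding F_def using lm Ulm by (intro measure_Un_le) (auto intro: fmeasurableD)
    finally show ?thesis
      using Um by simp
  qed
  have const: "F t = F s" if "{s..t} \<subseteq> U" "s \<le> t" for s t
  proof -
    have "{0..t} - {0..s} - U = {}"
      using that by (auto simp: subset_iff)
    then have "F t - F s = measure lebesgue ({} :: real set)"
      using step[OF that(2)] by metis
    then show ?thesis
      by simp
  qed
  show thesis
  proof (rule that[of "\<lambda>s. F s / F 1" "1 / F 1"])
    show "(1 / F 1)-lipschitz_on UNIV (\<lambda>s. F s / F 1)"
    proof (rule lipschitz_onI)
      fix x y :: real
      have "\<bar>F x - F y\<bar> \<le> \<bar>x - y\<bar>"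
        using lip[of x y] lip[of y x] mono[of x y] mono[of y x] by linarith
      then show "dist (F x / F 1) (F y / F 1) \<le> 1 / F 1 * dist x y"
        using F1 by (simp add: dist_real_def flip: diff_divide_distrib) (simp add: divide_right_mono)
    qed (use F1 in auto)
    fix a b :: real
    assume ab: "a < b"
    obtain s where s: "s \<in> \<rat>" "a < s" "s < b"
      using Rats_dense_in_real[OF ab] by blast
    then obtain d where d: "d > 0" "ball s d \<subseteq> U"
      using U(1,2) openE by blast
    have near: "F t = F s" if "dist t s < d" for t
    proof -
      have "{min s t..max s t} \<subseteq> ball s d"
        using that by (auto simp: dist_real_def min_def max_def split: if_splits)
      then have "F (max s t) = F (min s t)"
        using d by (intro const) auto
      then show ?thesis
        by (simp add: max_def min_def split: if_splits)
    qed
    have "\<forall>\<^sub>F t in nhds s. F t / F 1 = F s / F 1"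
      unfolding eventually_nhds_metric by (intro exI[of _ d] conjI allI impI d(1) arg_cong[OF near])
    then show "\<exists>s\<in>{a<..<b}. \<forall>\<^sub>F t in nhds s. F t / F 1 = F s / F 1"
      using s by auto
  qed (use F0 F1 in auto)
qed

text \<open>If \<open>x < y\<close> lie in different periods, the values are compared through the
  common value \<open>h 1 = h 0\<close>: first from \<open>frac x\<close> up to 1, then from 0 to
  \<open>frac y\<close>. These two pieces together are no longer than \<open>y - x\<close>.\<close>

lemma lipschitz_on_frac:
  fixes h :: "real \<Rightarrow> real"
  assumes lip: "K-lipschitz_on {0..1} h" and h: "h 0 = h 1"
  shows "K-lipschitz_on UNIV (\<lambda>x. h (frac x))"
proof -
  have K: "K \<ge> 0"
    using lip lipschitz_on_nonneg by blast
  have L: "\<bar>h x - h y\<bar> \<le> K * \<bar>x - y\<bar>" if "x \<in> {0..1}" "y \<in> {0..1}" for x y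
    using lipschitz_onD[OF lip that] by (simp add: dist_real_def)
  have fr: "frac x \<in> {0..1}" for x :: real
    using frac_lt_1[of x] by (simp add: less_imp_le)
  have main: "\<bar>h (frac x) - h (frac y)\<bar> \<le> K * (y - x)" if "x \<le> y" for x y
  proof (cases "\<lfloor>x\<rfloor> = \<lfloor>y\<rfloor>")
    case True
    then show ?thesis
      using L[OF fr[of x] fr[of y]] that by (simp add: frac_def)
  next
    case False
    then have "\<lfloor>x\<rfloor> + 1 \<le> \<lfloor>y\<rfloor>"
      using floor_mono[OF that] by linarith
    then have fl: "(1 - frac x) + frac y \<le> y - x"
      unfolding frac_def by linarith
    have "\<bar>h (frac x) - h (frac y)\<bar> \<le> K * \<bar>frac x - 1\<bar> + K * \<bar>0 - frac y\<bar>"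
      using L[OF fr[of x], of 1] L[OF _ fr[of y], of 0] h by fastforce
    also have "\<dots> = K * ((1 - frac x) + frac y)"
      using fr[of x] fr[of y] by (simp add: algebra_simps abs_if)
    also have "\<dots> \<le> K * (y - x)"
      using fl K by (rule mult_left_mono)
    finally show ?thesis .
  qed
  show ?thesis
  proof (rule lipschitz_onI)
    fix x y :: real
    show "dist (h (frac x)) (h (frac y)) \<le> K * dist x y"
      using main[of x y] main[of y x] by (cases "x \<le> y") (auto simp: dist_real_def abs_minus_commute)
  qed (rule K)
qed

text \<open>Staircase minus identity vanishes at 0 and 1, so it extends periodically. Stretching
  argument and value by the same factor \<open>2 * pi\<close> changes the period but neither the
  Lipschitz constant nor the slope -1.\<close>

lemma periodic_zigzag:
  obtains \<xi> :: "real \<Rightarrow> real" and K B :: real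
  where "\<And>s. \<xi> (s + 2 * pi) = \<xi> s" "K-lipschitz_on UNIV \<xi>" "\<And>s. \<bar>\<xi> s\<bar> \<le> B"
    "\<And>a b. a < b \<Longrightarrow> \<exists>s\<in>{a<..<b}. \<forall>\<^sub>F t in nhds s. \<xi> t = \<xi> s - (t - s)"
proof -
  obtain \<phi> :: "real \<Rightarrow> real" and L :: real
    where \<phi>: "\<phi> 0 = 0" "\<phi> 1 = 1" "L-lipschitz_on UNIV \<phi>"
      and flat: "\<And>a b. 0 \<le> a \<Longrightarrow> a < b \<Longrightarrow> b \<le> 1 \<Longrightarrow> \<exists>s\<in>{a<..<b}. \<forall>\<^sub>F t in nhds s. \<phi> t = \<phi> s"
    using devil_staircase by blast
  define h where "h = (\<lambda>x. \<phi> x - x)"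
  have "(L + 1)-lipschitz_on {0..1} h"
  proof (rule lipschitz_onI)
    fix x y :: real
    show "dist (h x) (h y) \<le> (L + 1) * dist x y"
      using lipschitz_onD[OF \<phi>(3), of x y] by (simp add: h_def dist_real_def distrib_right)
  next
    show "0 \<le> L + 1"
      using lipschitz_on_nonneg[OF \<phi>(3)] by simp
  qed
  then have hlip: "(L + 1)-lipschitz_on UNIV (\<lambda>x. h (frac x))"
    using \<phi> by (intro lipschitz_on_frac) (auto simp: h_def)
  define \<xi> where "\<xi> = (\<lambda>s. 2 * pi * h (frac (s / (2 * pi))))"
  show thesis
  proof (rule that[of \<xi> "L + 1" "2 * pi * (L + 1)"])
    show "\<xi> (s + 2 * pi) = \<xi> s" for s
      by (simp add: \<xi>_def add_divide_distrib frac_1_eq)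
    show "(L + 1)-lipschitz_on UNIV \<xi>"
    proof (rule lipschitz_onI)
      fix x y :: real
      show "dist (\<xi> x) (\<xi> y) \<le> (L + 1) * dist x y"
      proof -
        have "dist (\<xi> x) (\<xi> y) = 2 * pi * dist (h (frac (x / (2 * pi)))) (h (frac (y / (2 * pi))))"
          by (simp add: \<xi>_def dist_real_def abs_mult flip: right_diff_distrib)
        also have "\<dots> \<le> 2 * pi * ((L + 1) * dist (x / (2 * pi)) (y / (2 * pi)))"
          using lipschitz_onD[OF hlip, of "x / (2 * pi)" "y / (2 * pi)"] by (intro mult_left_mono) auto
        also have "\<dots> = (L + 1) * dist x y"
          by (simp add: dist_real_def flip: diff_divide_distrib)
        finally show ?thesis .
      qed
    qed (use hlip lipschitz_on_nonneg in blast)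
    show "\<bar>\<xi> s\<bar> \<le> 2 * pi * (L + 1)" for s
    proof -
      have "\<bar>h (frac x)\<bar> \<le> L + 1" for x :: real
      proof -
        have "\<bar>h (frac x) - h (frac 0)\<bar> = \<bar>h (frac (frac x)) - h (frac 0)\<bar>"
          by simp
        also have "\<dots> \<le> (L + 1) * \<bar>frac x\<bar>"
          using lipschitz_onD[OF hlip, of "frac x" 0] by (simp add: dist_real_def)
        also have "\<dots> \<le> (L + 1) * 1"
          using frac_lt_1[of x] hlip lipschitz_on_nonneg[OF hlip] by (intro mult_left_mono) auto
        finally show ?thesis
          using \<phi>(1) by (simp add: h_def)
      qed
      then show ?thesis
        by (simp add: \<xi>_def abs_mult)
    qed
    fix a b :: real
    assume "a < b"
    \<comment> \<open>After rescaling, the interval is moved by \<open>n\<close> periods so that its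
      left end lies in [0, 1), and cut off at 1. This brings it into the range where
      \<open>flat\<close> applies; \<open>S\<close> below is the point found, moved back.\<close>
    define n where "n = \<lfloor>a / (2 * pi)\<rfloor>"
    define a' where "a' = a / (2 * pi) - n"
    define b' where "b' = min 1 (b / (2 * pi) - n)"
    have "0 \<le> a'" "a' < 1" "b' \<le> 1"
      unfolding a'_def b'_def n_def by linarith+
    moreover have "a' < b'"
      using \<open>a' < 1\<close> \<open>a < b\<close> by (simp add: a'_def b'_def divide_strict_right_mono)
    ultimately obtain s where s: "a' < s" "s < b'" and ev: "\<forall>\<^sub>F t in nhds s. \<phi> t = \<phi> s"
      using flat[of a' b'] by auto
    have s01: "0 < s" "s < 1"
      using s \<open>0 \<le> a'\<close> \<open>b' \<le> 1\<close> by auto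
    define S where "S = 2 * pi * (s + n)"
    \<comment> \<open>Staying strictly between 0 and 1 keeps the floor equal to \<open>n\<close>
      near \<open>S\<close>, so \<open>frac\<close> is there a mere translation.\<close>
    have "\<forall>\<^sub>F x in nhds s. \<phi> x = \<phi> s \<and> 0 < x \<and> x < 1"
      using ev eventually_nhds_in_open[of "{0<..<1}" s] s01 by (simp add: eventually_conj_iff)
    moreover have "((\<lambda>t. t / (2 * pi) - n) \<longlongrightarrow> S / (2 * pi) - n) (nhds S)"
      by (intro tendsto_intros filterlim_ident) auto
    then have "filterlim (\<lambda>t. t / (2 * pi) - n) (nhds s) (nhds S)"
      by (simp add: S_def)
    ultimately have "\<forall>\<^sub>F t in nhds S. \<phi> (t / (2 * pi) - n) = \<phi> s \<and> 0 < t / (2 * pi) - n \<and> t / (2 * pi) - n < 1"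
      by (rule eventually_compose_filterlim)
    then have "\<forall>\<^sub>F t in nhds S. \<xi> t = \<xi> S - (t - S)"
    proof (eventually_elim)
      case (elim t)
      then have "\<lfloor>t / (2 * pi)\<rfloor> = n" "\<lfloor>S / (2 * pi)\<rfloor> = n"
        using s01 by (auto simp: S_def intro!: floor_unique)
      then have *: "frac (t / (2 * pi)) = t / (2 * pi) - n" "frac (S / (2 * pi)) = s"
        by (auto simp: frac_def S_def)
      show ?case
        unfolding \<xi>_def * h_def using elim by (simp add: S_def field_simps)
    qed
    moreover have "a < S" "S < b"
      using s by (auto simp: S_def a'_def b'_def field_simps)
    ultimately show "\<exists>s\<in>{a<..<b}. \<forall>\<^sub>F t in nhds s. \<xi> t = \<xi> s - (t - s)"
      by auto
  qed
qed

section \<open>Gradients and Clarke subdifferentials of Lipschitz functions\<close>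

text \<open>In the direction of the gradient \<open>v\<close> itself the derivative is
  \<open>v \<bullet> v\<close>, while difference quotients are at most
  \<open>L * norm v\<close>.\<close>

lemma norm_GDERIV_le:
  fixes f :: "'a::real_inner \<Rightarrow> real"
  assumes lip: "L-lipschitz_on UNIV f" and v: "GDERIV f x :> v"
  shows "norm v \<le> L"
proof -
  define g where "g = (\<lambda>t::real. f (x + t *\<^sub>R v))"
  have "((\<lambda>t::real. x + t *\<^sub>R v) has_derivative (\<lambda>t. t *\<^sub>R v)) (at 0)"
    by (auto intro!: derivative_eq_intros)
  moreover have "(f has_derivative (\<lambda>h. h \<bullet> v)) (at (x + 0 *\<^sub>R v))"
    using v by (simp add: gderiv_def)
  ultimately have "(g has_derivative (\<lambda>t. (t *\<^sub>R v) \<bullet> v)) (at 0)"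
    unfolding g_def by (rule has_derivative_compose)
  then have "DERIV g 0 :> v \<bullet> v"
    by (simp add: has_field_derivative_def mult_commute_abs)
  then have "(\<lambda>h. (g h - g 0) / h) \<midarrow>0\<rightarrow> v \<bullet> v"
    by (simp add: DERIV_def)
  moreover have "\<forall>\<^sub>F h in at 0. (g h - g 0) / h \<le> L * norm v"
    unfolding eventually_at_filter
  proof (intro always_eventually allI impI)
    fix h :: real
    assume "h \<noteq> 0"
    have "\<bar>g h - g 0\<bar> \<le> L * (\<bar>h\<bar> * norm v)"
      using lipschitz_onD[OF lip, of "x + h *\<^sub>R v" x] by (simp add: g_def dist_norm)
    then have "\<bar>(g h - g 0) / h\<bar> \<le> L * norm v"
      using \<open>h \<noteq> 0\<close> by (simp add: field_simps)
    then show "(g h - g 0) / h \<le> L * norm v"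
      by linarith
  qed
  ultimately have "v \<bullet> v \<le> L * norm v"
    by (rule tendsto_upperbound) simp
  then have "norm v * norm v \<le> L * norm v"
    by (simp add: power2_norm_eq_inner[symmetric] power2_eq_square)
  then show ?thesis
    using lipschitz_on_nonneg[OF lip] by (cases "v = 0") auto
qed

text \<open>Gradients at points tending to \<open>x\<close> are bounded by \<open>L\<close>, so a
  subsequence of them converges, and its limit is a subgradient.\<close>

lemma clarke_subdifferential_nonempty:
  fixes f :: "'a::euclidean_space \<Rightarrow> real"
  assumes lip: "L-lipschitz_on UNIV f"
    and dense: "\<And>e. e > 0 \<Longrightarrow> \<exists>y v. dist y x < e \<and> GDERIV f y :> v"
  shows "clarke_subdifferential UNIV f x \<noteq> {}"
proof -
  have "\<exists>y v. dist y x < inverse (Suc n) \<and> GDERIV f y :> v" for n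
    by (intro dense) simp
  then obtain xs gs where xs: "\<And>n. dist (xs n) x < inverse (Suc n)" and gs: "\<And>n. GDERIV f (xs n) :> gs n"
    by metis
  have "norm (gs n) \<le> L" for n
    using norm_GDERIV_le lip gs by blast
  then have "bounded (range gs)"
    unfolding bounded_iff by blast
  then obtain l r where r: "strict_mono r" "(gs \<circ> r) \<longlonglongrightarrow> l"
    using bounded_imp_convergent_subsequence by blast
  have "(\<lambda>n. dist (xs n) x) \<longlonglongrightarrow> 0"
    by (rule tendsto_sandwich[OF _ _ tendsto_const LIMSEQ_inverse_real_of_nat])
       (auto intro!: always_eventually less_imp_le[OF xs[simplified]])
  then have "xs \<longlonglongrightarrow> x"
    using tendsto_dist_iff by blast
  then have "(xs \<circ> r) \<longlonglongrightarrow> x"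
    using r(1) LIMSEQ_subseq_LIMSEQ by blast
  then have "l \<in> clarke_subdifferential UNIV f x"
    unfolding clarke_subdifferential_def using r gs
    by (intro hull_inc CollectI exI[of _ "xs \<circ> r"] exI[of _ "gs \<circ> r"]) auto
  then show ?thesis
    by blast
qed

text \<open>The equation survives limits because \<open>W\<close> is continuous at \<open>x\<close>,
  and it survives the convex hull because its solutions form a hyperplane or another convex
  set.\<close>

lemma clarke_subdifferential_inner_eq:
  fixes f :: "'a::euclidean_space \<Rightarrow> real"
  assumes W: "isCont W x" and eq: "\<And>y v. GDERIV f y :> v \<Longrightarrow> v \<bullet> W y = c"
    and v: "v \<in> clarke_subdifferential U f x"
  shows "v \<bullet> W x = c"
proof -
  let ?S = "{v. \<exists>xs gs. (\<forall>k::nat. xs k \<in> U \<and> GDERIV f (xs k) :> gs k) \<and> xs \<longlonglongrightarrow> x \<and> gs \<longlonglongrightarrow> v}"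
  have "?S \<subseteq> {v. W x \<bullet> v = c}"
  proof safe
    fix v and xs gs :: "nat \<Rightarrow> 'a"
    assume *: "\<forall>k. xs k \<in> U \<and> GDERIV f (xs k) :> gs k" "xs \<longlonglongrightarrow> x" "gs \<longlonglongrightarrow> v"
    have "(\<lambda>k. gs k \<bullet> W (xs k)) \<longlonglongrightarrow> v \<bullet> W x"
      using * by (intro tendsto_inner isCont_tendsto_compose[OF W])
    moreover have "(\<lambda>k. gs k \<bullet> W (xs k)) = (\<lambda>k. c)"
      using * eq by auto
    ultimately show "W x \<bullet> v = c"
      using LIMSEQ_const_iff by (metis inner_commute)
  qed
  then have "convex hull ?S \<subseteq> {v. W x \<bullet> v = c}"
    by (intro hull_minimal convex_hyperplane)
  then show ?thesis
    using v unfolding clarke_subdifferential_def by (auto simp: inner_commute)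
qed

lemma GDERIV_along_curve:
  fixes f :: "'a::real_inner \<Rightarrow> real"
  assumes "GDERIV f (\<gamma> 0) :> v" "(\<gamma> has_vector_derivative w) (at 0)"
    "((\<lambda>t. f (\<gamma> t)) has_real_derivative c) (at 0)"
  shows "v \<bullet> w = c"
proof -
  have "((\<lambda>t. f (\<gamma> t)) has_derivative (\<lambda>t. (t *\<^sub>R w) \<bullet> v)) (at 0)"
    using assms(1,2) unfolding gderiv_def has_vector_derivative_def
    by (rule has_derivative_compose[rotated])
  then have "((\<lambda>t. f (\<gamma> t)) has_real_derivative (v \<bullet> w)) (at 0)"
    by (simp add: has_field_derivative_def inner_commute mult_commute_abs)
  then show ?thesis
    using assms(3) DERIV_unique by blast
qed

lemma GDERIV_exists:
  fixes f :: "'a::euclidean_space \<Rightarrow> real"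
  assumes "f differentiable at x"
  obtains v where "GDERIV f x :> v"
proof -
  obtain f' where f': "(f has_derivative f') (at x)"
    using assms unfolding differentiable_def by blast
  then interpret linear f'
    by (rule has_derivative_linear)
  have "f' = (\<lambda>h. h \<bullet> (\<Sum>b\<in>Basis. f' b *\<^sub>R b))"
  proof
    fix h
    have "f' h = f' (\<Sum>b\<in>Basis. (h \<bullet> b) *\<^sub>R b)"
      by (simp add: euclidean_representation)
    also have "\<dots> = h \<bullet> (\<Sum>b\<in>Basis. f' b *\<^sub>R b)"
      by (simp add: sum scale inner_sum_right mult.commute)
    finally show "f' h = h \<bullet> (\<Sum>b\<in>Basis. f' b *\<^sub>R b)" .
  qed
  then show thesis
    using f' that unfolding gderiv_def by metis
qed

section \<open>Cylindrical coordinates on the four-dimensional space\<close>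

text \<open>Near 1 this follows from the estimate for the principal logarithm. Elsewhere the
  distance to 1 is at least 1/2, and the factor \<open>2 * pi\<close> makes the right side at least
  \<open>pi\<close>.\<close>

lemma abs_Arg_le: "\<bar>Arg u\<bar> \<le> 2 * pi * cmod (u - 1)"
proof (cases "cmod (u - 1) < 1 / 2")
  case True
  then have "u \<noteq> 0"
    by auto
  then have "\<bar>Arg u\<bar> \<le> cmod (Ln u)"
    using abs_Im_le_cmod[of "Ln u"] by (simp add: Arg_eq_Im_Ln)
  also have "\<dots> \<le> 2 * cmod (u - 1)"
    using norm_Ln_le[of "u - 1"] True by simp
  also have "\<dots> \<le> 2 * pi * cmod (u - 1)"
    using pi_ge_two by (intro mult_right_mono) auto
  finally show ?thesis .
next
  case False
  have "\<bar>Arg u\<bar> \<le> pi"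
    using mpi_less_Arg[of u] Arg_le_pi[of u] by linarith
  also have "\<dots> \<le> 2 * pi * cmod (u - 1)"
    using False by simp
  finally show ?thesis .
qed

text \<open>As a complex number the horizontal part has \<open>Arg\<close> as its polar angle, and
  rotation becomes multiplication by \<open>cis\<close>.\<close>

definition xy :: "real ^ 4 \<Rightarrow> complex" where
  "xy X = Complex (X $ 1) (X $ 2)"

text \<open>The generator of rotations about the axis \<open>xy X = 0\<close>. Off the axis it is
  \<open>r\<^sup>2\<close> times the gradient of the polar angle; without the division it is linear
  and makes sense on the axis too.\<close>

definition azimuthal :: "real ^ 4 \<Rightarrow> real ^ 4" where
  "azimuthal X = - (X $ 2) *\<^sub>R axis 1 1 + X $ 1 *\<^sub>R axis 2 1"

lemma azimuthal_nth [simp]: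
  "azimuthal X $ 1 = - (X $ 2)" "azimuthal X $ 2 = X $ 1" "azimuthal X $ 3 = 0" "azimuthal X $ 4 = 0"
  by (simp_all add: azimuthal_def axis_def)

lemma bounded_linear_xy: "bounded_linear xy"
  unfolding xy_def
  by (auto intro!: linearI simp: complex_eq_iff simp flip: linear_conv_bounded_linear)

lemma bounded_linear_azimuthal: "bounded_linear azimuthal"
  unfolding azimuthal_def
  by (auto intro!: linearI simp: algebra_simps simp flip: linear_conv_bounded_linear)

lemma xy_add_axis3 [simp]: "xy (X + c *\<^sub>R axis 3 1) = xy X"
  by (simp add: xy_def axis_def)

lemma power2_norm_vec4: "(norm X)\<^sup>2 = (cmod (xy X))\<^sup>2 + (X $ 3)\<^sup>2 + (X $ 4)\<^sup>2"
proof -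
  have "(norm X)\<^sup>2 = (X $ 1)\<^sup>2 + (X $ 2)\<^sup>2 + (X $ 3)\<^sup>2 + (X $ 4)\<^sup>2"
    unfolding power2_norm_eq_inner by (simp add: inner_vec_def sum_4 power2_eq_square)
  then show ?thesis
    unfolding cmod_power2 by (simp add: xy_def)
qed

lemma norm_xy_le: "cmod (xy X) \<le> norm X"
  by (rule power2_le_imp_le) (simp_all add: power2_norm_vec4)

lemma isCont_xy: "isCont xy X"
  using bounded_linear_xy linear_continuous_at by blast

lemma isCont_tendsto_nhds: "isCont f x \<Longrightarrow> (f \<longlongrightarrow> f x) (nhds x)"
  by (simp add: isCont_def tendsto_at_iff_tendsto_nhds)

lemma has_derivative_transform_nhds:
  assumes "(f has_derivative f') (at x)" "\<forall>\<^sub>F y in nhds x. f y = g y"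
  shows "(g has_derivative f') (at x)"
proof (rule has_derivative_transform_eventually[OF assms(1)])
  show "\<forall>\<^sub>F y in at x. f y = g y"
    using assms(2) by (simp add: eventually_at_filter eventually_mono)
  show "f x = g x"
    using eventually_nhds_x_imp_x[OF assms(2)] .
qed simp

lemma axis_same_component [simp]: "axis i x $ i = x"
  by (simp add: axis_def)

lemma azimuthal_add_axis3 [simp]: "azimuthal (X + c *\<^sub>R axis 3 1) = azimuthal X"
proof -
  have "(axis 3 1 :: real ^ 4) $ 1 = 0" "(axis 3 1 :: real ^ 4) $ 2 = 0"
    by (simp_all add: axis_def)
  then show ?thesis
    by (simp add: azimuthal_def)
qed

section \<open>The function \<open>F\<close>, its gradients and its subgradients\<close>

locale zigzag =
  fixes \<xi> :: "real \<Rightarrow> real" and K B :: real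
  assumes periodic: "\<xi> (s + 2 * pi) = \<xi> s"
    and lip: "K-lipschitz_on UNIV \<xi>"
    and bound: "\<bar>\<xi> s\<bar> \<le> B"
    and descending: "a < b \<Longrightarrow> \<exists>s\<in>{a<..<b}. \<forall>\<^sub>F t in nhds s. \<xi> t = \<xi> s - (t - s)"
begin

lemma periodic_int: "\<xi> (s + 2 * pi * of_int n) = \<xi> s"
proof -
  have *: "\<xi> (s + 2 * pi * real k) = \<xi> s" for s k
  proof (induction k)
    case (Suc k)
    then show ?case
      using periodic[of "s + 2 * pi * real k"] by (simp add: algebra_simps)
  qed simp
  show ?thesis
  proof (cases "n \<ge> 0")
    case True
    then show ?thesis
      using *[of s "nat n"] by simp
  next
    case False
    then show ?thesis
      using *[of "s + 2 * pi * of_int n" "nat (- n)"] by simp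
  qed
qed

text \<open>Two angles of the same direction differ by a multiple of \<open>2 * pi\<close>, which
  the periodic \<open>\<xi>\<close> does not see. Hence any convenient branch may replace
  \<open>Arg\<close>, and its branch cut is harmless.\<close>

lemma zigzag_Arg:
  assumes "w \<noteq> 0" "cis a = sgn w"
  shows "\<xi> (z - Arg w) = \<xi> (z - a)"
proof -
  have "cis a = cis (Arg w)"
    using assms cis_Arg by simp
  then obtain n :: int where "a = Arg w + 2 * pi * n"
    using sin_cos_eq_iff[of a "Arg w"] by (auto simp: complex_eq_iff)
  then show ?thesis
    using periodic_int[of "z - a" n] by simp
qed

text \<open>The factor \<open>min 1 r\<close> damps the oscillation towards the axis, where the
  angle is undefined. \<open>F\<close> is constant along the fourth axis, so the construction is
  three-dimensional.\<close>

definition F :: "real ^ 4 \<Rightarrow> real" where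
  "F X = X $ 3 + min 1 (cmod (xy X)) * \<xi> (X $ 3 - Arg (xy X))"

lemma F_eq:
  assumes "xy X \<noteq> 0" "cis a = sgn (xy X)"
  shows "F X = X $ 3 + min 1 (cmod (xy X)) * \<xi> (X $ 3 - a)"
  unfolding F_def using zigzag_Arg[OF assms] by simp

lemma K_nonneg: "K \<ge> 0"
  using lip lipschitz_on_nonneg by blast

lemma B_nonneg: "B \<ge> 0"
  using bound[of 0] by linarith

text \<open>The constant collects 1 from the summand \<open>X $ 3\<close>, \<open>B\<close> from the
  factor \<open>min 1 r\<close>, \<open>K\<close> from the height inside \<open>\<xi>\<close> and
  \<open>2 * pi * K\<close> from the angle. The angle varies at a rate of order
  \<open>1 / r\<close>, which \<open>min 1 r \<le> r\<close> compensates.\<close>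

lemma F_lipschitz: "(1 + B + K + 2 * pi * K)-lipschitz_on UNIV F"
proof (rule lipschitz_onI)
  fix X Y :: "real ^ 4"
  define u v d where "u = xy X" and "v = xy Y" and "d = dist X Y"
  have z: "\<bar>X $ 3 - Y $ 3\<bar> \<le> d"
    using dist_vec_nth_le[of X 3 Y] by (simp add: d_def dist_real_def)
  have uv: "cmod (u - v) \<le> d"
    using norm_xy_le[of "X - Y"] linear_diff[OF bounded_linear.linear[OF bounded_linear_xy], of X Y]
    by (simp add: u_def v_def d_def dist_norm)
  have "d \<ge> 0"
    by (simp add: d_def)
  let ?P = "\<lambda>X w. min 1 (cmod w) * \<xi> (X $ 3 - Arg w)"
  have m: "\<bar>min 1 (cmod u) - min 1 (cmod v)\<bar> \<le> d"
    using uv norm_triangle_ineq3[of u v] by linarith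
  have "\<bar>?P X u - ?P Y v\<bar> \<le> B * d + (K * d + 2 * pi * K * d)"
  proof (cases "u = 0 \<or> v = 0")
    case True
    then have "\<bar>?P X u - ?P Y v\<bar> \<le> B * d"
    proof
      assume "u = 0"
      then have "\<bar>\<xi> (Y $ 3 - Arg v)\<bar> * \<bar>min 1 (cmod v)\<bar> \<le> B * d"
        using m B_nonneg bound by (intro mult_mono) auto
      then show ?thesis
        using \<open>u = 0\<close> by (simp add: abs_mult mult.commute)
    next
      assume "v = 0"
      then have "\<bar>\<xi> (X $ 3 - Arg u)\<bar> * \<bar>min 1 (cmod u)\<bar> \<le> B * d"
        using m B_nonneg bound by (intro mult_mono) auto
      then show ?thesis
        using \<open>v = 0\<close> by (simp add: abs_mult mult.commute)
    qed
    then show ?thesis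
      using K_nonneg \<open>d \<ge> 0\<close> by (simp add: add_increasing2)
  next
    case False
    \<comment> \<open>This angle of \<open>v\<close> is measured starting from that of
      \<open>u\<close>, so the two differ by \<open>Arg (v / u)\<close>, which is small for
      \<open>v\<close> close to \<open>u\<close> even across the branch cut.\<close>
    define a where "a = Arg u + Arg (v / u)"
    have "cis a = sgn v"
      using False by (simp add: a_def cis_Arg sgn_divide sgn_zero_iff flip: cis_mult)
    then have Py: "?P Y v = min 1 (cmod v) * \<xi> (Y $ 3 - a)"
      using zigzag_Arg[of v a] False by simp
    have "min 1 (cmod u) * \<bar>Arg (v / u)\<bar> \<le> cmod u * (2 * pi * cmod (v / u - 1))"
      by (intro mult_mono abs_Arg_le) auto
    also have "\<dots> = 2 * pi * cmod (u * (v / u - 1))"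
      by (simp add: norm_mult)
    also have "u * (v / u - 1) = v - u"
      using False by (simp add: field_simps)
    also have "2 * pi * cmod (v - u) \<le> 2 * pi * d"
      using uv by (simp add: norm_minus_commute)
    finally have A: "min 1 (cmod u) * \<bar>Arg (v / u)\<bar> \<le> 2 * pi * d" .
    have "\<bar>\<xi> (X $ 3 - Arg u) - \<xi> (Y $ 3 - a)\<bar> \<le> K * \<bar>(X $ 3 - Arg u) - (Y $ 3 - a)\<bar>"
      using lipschitz_onD[OF lip] by (simp add: dist_real_def)
    also have "\<dots> \<le> K * (d + \<bar>Arg (v / u)\<bar>)"
      using z K_nonneg by (intro mult_left_mono) (auto simp: a_def)
    finally have "min 1 (cmod u) * \<bar>\<xi> (X $ 3 - Arg u) - \<xi> (Y $ 3 - a)\<bar>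
        \<le> min 1 (cmod u) * (K * (d + \<bar>Arg (v / u)\<bar>))"
      by (intro mult_left_mono) auto
    also have "\<dots> = K * (min 1 (cmod u) * d) + K * (min 1 (cmod u) * \<bar>Arg (v / u)\<bar>)"
      by (simp add: algebra_simps)
    also have "\<dots> \<le> K * (1 * d) + K * (2 * pi * d)"
      using A K_nonneg \<open>d \<ge> 0\<close> by (intro add_mono mult_left_mono mult_right_mono) auto
    finally have 1: "min 1 (cmod u) * \<bar>\<xi> (X $ 3 - Arg u) - \<xi> (Y $ 3 - a)\<bar> \<le> K * d + 2 * pi * K * d"
      by (simp add: mult_ac)
    have 2: "\<bar>\<xi> (Y $ 3 - a)\<bar> * \<bar>min 1 (cmod u) - min 1 (cmod v)\<bar> \<le> B * d"
      using m bound B_nonneg by (intro mult_mono) auto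
    have "?P X u - ?P Y v = \<xi> (Y $ 3 - a) * (min 1 (cmod u) - min 1 (cmod v))
        + min 1 (cmod u) * (\<xi> (X $ 3 - Arg u) - \<xi> (Y $ 3 - a))"
      unfolding Py by (simp add: algebra_simps)
    also have "\<bar>\<dots>\<bar> \<le> \<bar>\<xi> (Y $ 3 - a)\<bar> * \<bar>min 1 (cmod u) - min 1 (cmod v)\<bar>
        + min 1 (cmod u) * \<bar>\<xi> (X $ 3 - Arg u) - \<xi> (Y $ 3 - a)\<bar>"
      by (rule order_trans[OF abs_triangle_ineq]) (simp add: abs_mult)
    finally show ?thesis
      using 1 2 by linarith
  qed
  then have "\<bar>F X - F Y\<bar> \<le> d + (B * d + (K * d + 2 * pi * K * d))"
    using z unfolding F_def u_def v_def by linarith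
  then show "dist (F X) (F Y) \<le> (1 + B + K + 2 * pi * K) * dist X Y"
    by (simp add: dist_real_def d_def algebra_simps)
qed (use K_nonneg B_nonneg in simp)

text \<open>On the helix both \<open>r\<close> and the difference of height and angle are constant,
  so only the first summand of \<open>F\<close> changes.\<close>

lemma GDERIV_F_helical:
  assumes "GDERIV F X :> v"
  shows "v \<bullet> (azimuthal X + axis 3 1) = 1"
proof -
  \<comment> \<open>\<open>P\<close> is the horizontal part of \<open>X\<close>. The curve
    \<open>\<gamma>\<close> turns it by the angle \<open>t\<close> and raises it by
    \<open>t\<close>; it degenerates to a vertical line when \<open>X\<close> is on the
    axis.\<close>
  define P :: "real ^ 4" where "P = axis 1 (X $ 1) + axis 2 (X $ 2)"
  define \<gamma> where "\<gamma> = (\<lambda>t. X + (cos t - 1) *\<^sub>R P + sin t *\<^sub>R azimuthal X + t *\<^sub>R axis 3 1)"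
  have [simp]: "P $ 1 = X $ 1" "P $ 2 = X $ 2" "P $ 3 = 0"
    by (simp_all add: P_def axis_def)
  have xy: "xy (\<gamma> t) = cis t * xy X" and z: "\<gamma> t $ 3 = X $ 3 + t" for t
    by (simp_all add: \<gamma>_def xy_def complex_eq_iff axis_def algebra_simps)
  have F\<gamma>: "F (\<gamma> t) = F X + t" for t
  proof (cases "xy X = 0")
    case True
    then show ?thesis
      by (simp add: F_def xy z)
  next
    case False
    then have "cis (t + Arg (xy X)) = sgn (xy (\<gamma> t))"
      by (simp add: xy cis_Arg sgn_mult flip: cis_mult)
    then have "F (\<gamma> t) = \<gamma> t $ 3 + min 1 (cmod (xy (\<gamma> t))) * \<xi> (\<gamma> t $ 3 - (t + Arg (xy X)))"
      using False by (intro F_eq) (auto simp: xy)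
    then show ?thesis
      by (simp add: F_def xy z norm_mult)
  qed
  show ?thesis
  proof (rule GDERIV_along_curve)
    show "GDERIV F (\<gamma> 0) :> v"
      using assms by (simp add: \<gamma>_def)
    show "(\<gamma> has_vector_derivative azimuthal X + axis 3 1) (at 0)"
      unfolding \<gamma>_def by (auto intro!: derivative_eq_intros)
    show "((\<lambda>t. F (\<gamma> t)) has_real_derivative 1) (at 0)"
      unfolding F\<gamma> by (auto intro!: derivative_eq_intros)
  qed
qed

text \<open>For \<open>Y\<close> near \<open>X\<close> the quotient \<open>xy Y / xy X\<close> is
  near 1, where \<open>Ln\<close> is smooth. This gives a smooth local branch of the angle, at which
  the descending piece of \<open>\<xi>\<close> is evaluated.\<close>

lemma F_locally:
  assumes "xy X \<noteq> 0" and ev: "\<forall>\<^sub>F t in nhds s. \<xi> t = \<xi> s - (t - s)" and s: "s = X $ 3 - Arg (xy X)"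
  shows "\<forall>\<^sub>F Y in nhds X. F Y = Y $ 3 + min 1 (cmod (xy Y)) * (\<xi> s + X $ 3 - Y $ 3 + Im (Ln (xy Y / xy X)))"
proof -
  define \<theta> where "\<theta> = (\<lambda>Y. Arg (xy X) + Im (Ln (xy Y / xy X)))"
  have "isCont (\<lambda>Y. Y $ 3 - \<theta> Y) X"
    unfolding \<theta>_def using assms(1) isCont_xy[of X] by (intro continuous_intros isCont_Ln') auto
  from isCont_tendsto_nhds[OF this] have "filterlim (\<lambda>Y. Y $ 3 - \<theta> Y) (nhds s) (nhds X)"
    using assms(1) by (simp add: \<theta>_def s)
  with ev have "\<forall>\<^sub>F Y in nhds X. \<xi> (Y $ 3 - \<theta> Y) = \<xi> s - (Y $ 3 - \<theta> Y - s)"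
    by (rule eventually_compose_filterlim)
  moreover have "\<forall>\<^sub>F Y in nhds X. xy Y \<noteq> 0"
    using isCont_tendsto_nhds[OF isCont_xy] assms(1)
    by (rule tendsto_imp_eventually_ne)
  ultimately show ?thesis
  proof eventually_elim
    case (elim Y)
    have "cis (Im (Ln (xy Y / xy X))) = sgn (xy Y / xy X)"
      using elim assms(1) by (simp add: cis_Arg flip: Arg_eq_Im_Ln)
    then have "cis (\<theta> Y) = sgn (xy Y)"
      using assms(1) by (simp add: \<theta>_def cis_Arg sgn_divide sgn_zero_iff flip: cis_mult)
    then show ?case
      using elim F_eq[of Y "\<theta> Y"] by (simp add: s \<theta>_def)
  qed
qed

lemma has_derivative_angle:
  assumes "xy X \<noteq> 0"
  shows "((\<lambda>Y. Im (Ln (xy Y / xy X))) has_derivative (\<lambda>h. Im (xy h / xy X))) (at X)"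
proof -
  have "((\<lambda>Y. xy Y / xy X) has_derivative (\<lambda>h. xy h / xy X)) (at X)"
    using assms by (auto intro!: derivative_eq_intros bounded_linear.has_derivative[OF bounded_linear_xy])
  moreover have "(Ln has_derivative (*) 1) (at (xy X / xy X))"
    using assms has_field_derivative_Ln[of 1] by (simp add: has_field_derivative_def)
  ultimately have "((\<lambda>Y. Ln (xy Y / xy X)) has_derivative (\<lambda>h. 1 * (xy h / xy X))) (at X)"
    by (rule has_derivative_compose)
  then have "((\<lambda>Y. Im (Ln (xy Y / xy X))) has_derivative (\<lambda>h. Im (1 * (xy h / xy X)))) (at X)"
    by (rule bounded_linear.has_derivative[OF bounded_linear_Im])
  then show ?thesis
    by simp
qed

text \<open>Here the factor \<open>min 1 r\<close> is locally 1, so the slope -1 cancels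
  \<open>Y $ 3\<close>, and a constant plus the angle remains.\<close>

lemma GDERIV_F_outside:
  assumes "cmod (xy X) > 1" and ev: "\<forall>\<^sub>F t in nhds s. \<xi> t = \<xi> s - (t - s)"
    and s: "s = X $ 3 - Arg (xy X)"
  shows "GDERIV F X :> azimuthal X /\<^sub>R (cmod (xy X))\<^sup>2"
proof -
  have nz: "xy X \<noteq> 0"
    using assms(1) by auto
  have "((\<lambda>Y. \<xi> s + X $ 3 + Im (Ln (xy Y / xy X))) has_derivative (\<lambda>h. Im (xy h / xy X))) (at X)"
    using has_derivative_add[OF has_derivative_const[of "\<xi> s + X $ 3"] has_derivative_angle[OF nz]]
    by simp
  moreover have "\<forall>\<^sub>F Y in nhds X. cmod (xy Y) > 1"
    using order_tendstoD(1)[OF tendsto_norm[OF isCont_tendsto_nhds[OF isCont_xy]] assms(1)] .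
  then have "\<forall>\<^sub>F Y in nhds X. \<xi> s + X $ 3 + Im (Ln (xy Y / xy X)) = F Y"
    using F_locally[OF nz ev s] by eventually_elim simp
  ultimately have "(F has_derivative (\<lambda>h. Im (xy h / xy X))) (at X)"
    by (rule has_derivative_transform_nhds)
  moreover have "Im (xy h / xy X) = h \<bullet> (azimuthal X /\<^sub>R (cmod (xy X))\<^sup>2)" for h
  proof -
    have "h \<bullet> azimuthal X = Im (xy h) * Re (xy X) - Re (xy h) * Im (xy X)"
      by (simp add: inner_vec_def sum_4 xy_def)
    show ?thesis
      unfolding inner_scaleR_right \<open>h \<bullet> azimuthal X = _\<close> by (simp add: Im_divide cmod_power2 divide_inverse algebra_simps)
  qed
  ultimately show ?thesis
    unfolding gderiv_def by simp
qed

text \<open>For \<open>r\<close> at most 1 some subgradient is wanted but no particular one, so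
  differentiability nearby is enough. Both the axis, where \<open>r\<close> is not smooth, and the
  kink of \<open>min 1 r\<close> at \<open>r = 1\<close> are avoided.\<close>

lemma F_differentiable_inside:
  assumes "xy X \<noteq> 0" "cmod (xy X) < 1" and ev: "\<forall>\<^sub>F t in nhds s. \<xi> t = \<xi> s - (t - s)"
    and s: "s = X $ 3 - Arg (xy X)"
  shows "F differentiable at X"
proof -
  let ?g = "\<lambda>Y. Y $ 3 + cmod (xy Y) * (\<xi> s + X $ 3 - Y $ 3 + Im (Ln (xy Y / xy X)))"
  have "(\<lambda>Y. Im (Ln (xy Y / xy X))) differentiable at X"
    using has_derivative_angle[OF assms(1)] unfolding differentiable_def by blast
  moreover have "(\<lambda>Y. cmod (xy Y)) differentiable at X"
    using differentiable_chain_at[OF bounded_linear_imp_differentiable[OF bounded_linear_xy]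
        differentiable_norm_at[OF assms(1)]] by (simp add: o_def)
  moreover have "(\<lambda>Y :: real ^ 4. Y $ 3) differentiable at X"
    by (rule bounded_linear_imp_differentiable[OF bounded_linear_vec_nth])
  ultimately have "?g differentiable at X"
    by (intro differentiable_add differentiable_mult differentiable_diff differentiable_const)
  moreover have "\<forall>\<^sub>F Y in nhds X. cmod (xy Y) < 1"
    using order_tendstoD(2)[OF tendsto_norm[OF isCont_tendsto_nhds[OF isCont_xy]] assms(2)] .
  then have "\<forall>\<^sub>F Y in nhds X. ?g Y = F Y"
    using F_locally[OF assms(1) ev s] by eventually_elim simp
  ultimately show ?thesis
    unfolding differentiable_def by (elim exE, intro exI) (rule has_derivative_transform_nhds)
qed

lemma F_crit_empty: "clarke_critical UNIV F = {}"
proof -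
  have "v \<bullet> (azimuthal X + axis 3 1) = 1" if "v \<in> clarke_subdifferential UNIV F X" for v X
  proof (rule clarke_subdifferential_inner_eq[where W = "\<lambda>X. azimuthal X + axis 3 1"])
    show "isCont (\<lambda>X. azimuthal X + axis 3 1) X"
      using linear_continuous_at[OF bounded_linear_azimuthal] by (intro isCont_add continuous_const)
  qed (use that GDERIV_F_helical in auto)
  from this[of 0] show ?thesis
    unfolding clarke_critical_def by auto
qed

text \<open>Raising a point by \<open>c\<close> along the third axis shifts height minus angle by
  \<open>c\<close> and fixes \<open>xy\<close>. So arbitrarily small vertical shifts reach points
  where \<open>\<xi>\<close> descends with slope -1.\<close>

lemma descending_near:
  assumes "e > 0"
  obtains c where "0 < c" "c < e" "\<forall>\<^sub>F t in nhds (s + c). \<xi> t = \<xi> (s + c) - (t - (s + c))"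
proof -
  obtain s' where "s < s'" "s' < s + e" "\<forall>\<^sub>F t in nhds s'. \<xi> t = \<xi> s' - (t - s')"
    using descending[of s "s + e"] assms by auto
  then show thesis
    using that[of "s' - s"] by simp
qed

text \<open>The gradient in the outer region depends on \<open>xy X\<close> only, so the vertically
  shifted points tending to \<open>X\<close> all have the same gradient.\<close>

lemma azimuthal_in_clarke_subdifferential:
  assumes "cmod (xy X) > 1"
  shows "azimuthal X /\<^sub>R (cmod (xy X))\<^sup>2 \<in> clarke_subdifferential UNIV F X"
proof -
  let ?s = "X $ 3 - Arg (xy X)"
  have "\<forall>n. \<exists>c. 0 < c \<and> c < inverse (real (Suc n)) \<and>
      (\<forall>\<^sub>F t in nhds (?s + c). \<xi> t = \<xi> (?s + c) - (t - (?s + c)))"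
  proof
    fix n
    have "0 < inverse (real (Suc n))"
      by simp
    from descending_near[OF this] show "\<exists>c. 0 < c \<and> c < inverse (real (Suc n)) \<and>
        (\<forall>\<^sub>F t in nhds (?s + c). \<xi> t = \<xi> (?s + c) - (t - (?s + c)))"
      by blast
  qed
  from choice[OF this] obtain c where c: "\<And>n. 0 < c n" "\<And>n. c n < inverse (real (Suc n))"
      "\<And>n. \<forall>\<^sub>F t in nhds (?s + c n). \<xi> t = \<xi> (?s + c n) - (t - (?s + c n))"
    by blast
  have "c \<longlonglongrightarrow> 0"
  proof (rule tendsto_sandwich[OF _ _ tendsto_const LIMSEQ_inverse_real_of_nat])
    show "\<forall>\<^sub>F n in sequentially. 0 \<le> c n"
      by (rule always_eventually, rule allI, rule less_imp_le, rule c(1))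
    show "\<forall>\<^sub>F n in sequentially. c n \<le> inverse (real (Suc n))"
      by (rule always_eventually, rule allI, rule less_imp_le, rule c(2))
  qed
  then have "(\<lambda>n. X + c n *\<^sub>R axis 3 1) \<longlonglongrightarrow> X + 0 *\<^sub>R axis 3 1"
    by (intro tendsto_intros)
  then have lim: "(\<lambda>n. X + c n *\<^sub>R axis 3 1) \<longlonglongrightarrow> X"
    by simp
  have "GDERIV F (X + c n *\<^sub>R axis 3 1) :> azimuthal X /\<^sub>R (cmod (xy X))\<^sup>2" for n
    using GDERIV_F_outside[of "X + c n *\<^sub>R axis 3 1", OF _ c(3)[of n]] assms
    by simp
  then show ?thesis
    unfolding clarke_subdifferential_def using lim
    by (intro hull_inc CollectI exI[of _ "\<lambda>n. X + c n *\<^sub>R axis 3 1"]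
        exI[of _ "\<lambda>_. azimuthal X /\<^sub>R (cmod (xy X))\<^sup>2"]) auto
qed

lemma F_subdifferential_nonempty: "clarke_subdifferential UNIV F X \<noteq> {}"
proof (cases "cmod (xy X) > 1")
  case True
  then show ?thesis
    using azimuthal_in_clarke_subdifferential by blast
next
  case False
  show ?thesis
  proof (rule clarke_subdifferential_nonempty[OF F_lipschitz])
    fix e :: real
    assume "e > 0"
    \<comment> \<open>First move into the region \<open>0 < r < 1\<close>, sideways from the axis or
      radially inwards; the vertical shift by \<open>c\<close> then reaches a point of
      differentiability.\<close>
    obtain Y where Y: "dist Y X < e / 2" "xy Y \<noteq> 0" "cmod (xy Y) < 1"
    proof (cases "xy X = 0")
      case True
      define \<eta> where "\<eta> = min (1 / 2) (e / 4)"
      have "xy (X + \<eta> *\<^sub>R axis 1 1) = of_real \<eta>"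
        using True by (simp add: xy_def axis_def complex_eq_iff)
      then show thesis
        using \<open>e > 0\<close> by (intro that[of "X + \<eta> *\<^sub>R axis 1 1"]) (auto simp: \<eta>_def dist_norm norm_axis_1)
    next
      case nz: False
      define \<eta> where "\<eta> = min (1 / 2) (e / 4)"
      have \<eta>: "0 < \<eta>" "\<eta> < 1" "\<eta> < e / 2"
        using \<open>e > 0\<close> by (auto simp: \<eta>_def)
      \<comment> \<open>The radial part of \<open>X\<close>, of norm at most 1 here. Subtracting
        \<open>\<eta>\<close> times it scales \<open>r\<close> by \<open>1 - \<eta>\<close> at a
        displacement of at most \<open>\<eta>\<close>.\<close>
      define R :: "real ^ 4" where "R = axis 1 (X $ 1) + axis 2 (X $ 2)"
      have "(norm R)\<^sup>2 = (cmod (xy X))\<^sup>2"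
        unfolding power2_norm_vec4 by (simp add: R_def xy_def axis_def)
      then have "norm R \<le> 1"
        using False by simp
      then have "\<eta> * norm R < e / 2"
        using \<eta> mult_left_le[of "norm R" \<eta>] by linarith
      then have d: "dist (X - \<eta> *\<^sub>R R) X < e / 2"
        using \<eta> by (simp add: dist_norm)
      have xy: "xy (X - \<eta> *\<^sub>R R) = of_real (1 - \<eta>) * xy X"
        by (simp add: R_def xy_def axis_def complex_eq_iff algebra_simps)
      have "cmod (xy (X - \<eta> *\<^sub>R R)) = (1 - \<eta>) * cmod (xy X)"
        unfolding xy norm_mult norm_of_real using \<eta> by simp
      also have "\<dots> \<le> (1 - \<eta>) * 1"
        using \<eta> False by (intro mult_left_mono) auto
      finally have "cmod (xy (X - \<eta> *\<^sub>R R)) < 1"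
        using \<eta> by simp
      then show thesis
        using d xy nz \<eta> by (intro that[of "X - \<eta> *\<^sub>R R"]) (auto simp del: of_real_diff)
    qed
    let ?s = "Y $ 3 - Arg (xy Y)"
    obtain c where c: "0 < c" "c < e / 2" "\<forall>\<^sub>F t in nhds (?s + c). \<xi> t = \<xi> (?s + c) - (t - (?s + c))"
      using descending_near[of "e / 2" ?s] \<open>e > 0\<close> by auto
    have "F differentiable at (Y + c *\<^sub>R axis 3 1)"
      using F_differentiable_inside[of "Y + c *\<^sub>R axis 3 1", OF _ _ c(3)] Y by simp
    then obtain v where "GDERIV F (Y + c *\<^sub>R axis 3 1) :> v"
      by (rule GDERIV_exists)
    moreover have "dist (Y + c *\<^sub>R axis 3 1) Y < e / 2"
      using c by (simp add: dist_norm norm_axis_1)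
    then have "dist (Y + c *\<^sub>R axis 3 1) X < e"
      using Y(1) dist_triangle_half_l by (metis dist_commute)
    ultimately show "\<exists>y v. dist y X < e \<and> GDERIV F y :> v"
      by blast
  qed
qed

end

section \<open>The subgradient iteration\<close>

text \<open>The step is horizontal, orthogonal to the radius and of length
  \<open>\<bar>t\<bar> / r\<close>, so Pythagoras gives the new squared radius
  \<open>r\<^sup>2 + t\<^sup>2 / r\<^sup>2\<close>.\<close>

lemma azimuthal_step:
  fixes t :: real
  assumes "cmod (xy X) \<ge> 1" and Y: "Y = X - t *\<^sub>R (azimuthal X /\<^sub>R (cmod (xy X))\<^sup>2)"
  shows "(cmod (xy X))\<^sup>2 \<le> (cmod (xy Y))\<^sup>2" "(cmod (xy Y))\<^sup>2 \<le> (cmod (xy X))\<^sup>2 + t\<^sup>2"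
    "Y $ 3 = X $ 3" "Y $ 4 = X $ 4"
proof -
  define R where "R = (cmod (xy X))\<^sup>2"
  define a where "a = t / R"
  have "R \<ge> 1"
    using assms(1) by (simp add: R_def)
  have XR: "(X $ 1)\<^sup>2 + (X $ 2)\<^sup>2 = R"
    by (simp add: R_def cmod_power2 xy_def)
  have Y': "Y = X - a *\<^sub>R azimuthal X"
    by (simp add: Y a_def R_def divide_inverse)
  have "(cmod (xy Y))\<^sup>2 = (X $ 1 + a * X $ 2)\<^sup>2 + (X $ 2 - a * X $ 1)\<^sup>2"
    by (simp add: cmod_power2 xy_def Y')
  also have "\<dots> = ((X $ 1)\<^sup>2 + (X $ 2)\<^sup>2) + a\<^sup>2 * ((X $ 1)\<^sup>2 + (X $ 2)\<^sup>2)"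
    by (simp add: power2_eq_square algebra_simps)
  also have "\<dots> = R + t\<^sup>2 / R"
    unfolding XR using \<open>R \<ge> 1\<close> by (simp add: a_def power2_eq_square)
  finally have "(cmod (xy Y))\<^sup>2 = R + t\<^sup>2 / R" .
  moreover have "t\<^sup>2 / R \<le> t\<^sup>2" "0 \<le> t\<^sup>2 / R"
    using \<open>R \<ge> 1\<close> by (simp_all add: divide_le_eq mult_left_le mult_le_cancel_left1)
  ultimately show "(cmod (xy X))\<^sup>2 \<le> (cmod (xy Y))\<^sup>2" "(cmod (xy Y))\<^sup>2 \<le> (cmod (xy X))\<^sup>2 + t\<^sup>2"
    unfolding R_def by linarith+
  show "Y $ 3 = X $ 3" "Y $ 4 = X $ 4"
    by (simp_all add: Y')
qed

text \<open>The radius never decreases, so the iterates stay in the region where \<open>G\<close> is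
  known. The squared norm then grows by at most the sum of the squared step sizes.\<close>

lemma azimuthal_iteration_bounded:
  fixes X :: "nat \<Rightarrow> real ^ 4"
  assumes G: "\<And>X. cmod (xy X) > 1 \<Longrightarrow> G X = azimuthal X /\<^sub>R (cmod (xy X))\<^sup>2"
    and X0: "cmod (xy (X 0)) > 1" and step: "\<And>n. X (Suc n) = X n - t n *\<^sub>R G (X n)"
    and t: "summable (\<lambda>n. (t n)\<^sup>2)"
  shows "bounded (range X)"
proof -
  have inv: "1 < cmod (xy (X n)) \<and> (norm (X n))\<^sup>2 \<le> (norm (X 0))\<^sup>2 + (\<Sum>k<n. (t k)\<^sup>2)" for n
  proof (induction n)
    case (Suc n)
    then have 1: "1 \<le> cmod (xy (X n))" and eq: "X (Suc n) = X n - t n *\<^sub>R (azimuthal (X n) /\<^sub>R (cmod (xy (X n)))\<^sup>2)"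
      using step[of n] G[of "X n"] by auto
    note * = azimuthal_step[OF 1 eq]
    have "cmod (xy (X n)) \<le> cmod (xy (X (Suc n)))"
      using *(1) by (rule power2_le_imp_le) simp
    moreover have "(norm (X (Suc n)))\<^sup>2 \<le> (norm (X n))\<^sup>2 + (t n)\<^sup>2"
      using *(2-4) unfolding power2_norm_vec4 by simp
    ultimately show ?case
      using Suc by simp
  qed (use X0 in simp)
  have "norm (X n) \<le> sqrt ((norm (X 0))\<^sup>2 + (\<Sum>k. (t k)\<^sup>2))" for n
  proof -
    have "(\<Sum>k<n. (t k)\<^sup>2) \<le> (\<Sum>k. (t k)\<^sup>2)"
      by (rule sum_le_suminf[OF t]) auto
    then show ?thesis
      using inv[of n] by (intro real_le_rsqrt) linarith
  qed
  then show ?thesis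
    unfolding bounded_iff by blast
qed

theorem theorem6:
  shows "\<exists>(f :: real ^ 4 \<Rightarrow> real) (G :: real ^ 4 \<Rightarrow> real ^ 4) (Xbar :: real ^ 4).
    (\<exists>L. L-lipschitz_on UNIV f) \<and>
    (\<forall>X. G X \<in> clarke_subdifferential UNIV f X) \<and>
    (\<forall>(t :: nat \<Rightarrow> real) (X :: nat \<Rightarrow> real ^ 4).
       (\<forall>n. 0 < t n) \<longrightarrow>
       filterlim (\<lambda>N. \<Sum>n<N. t n) at_top sequentially \<longrightarrow>
       summable (\<lambda>n. (t n)\<^sup>2) \<longrightarrow>
       X 0 = Xbar \<longrightarrow>
       (\<forall>n. X (Suc n) = X n - t n *\<^sub>R G (X n)) \<longrightarrow>
       bounded (range X) \<and>
       (\<forall>x. accumulation_point X x \<longrightarrow> x \<notin> clarke_critical UNIV f))"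
proof -
  obtain \<xi> :: "real \<Rightarrow> real" and K B :: real where
    "\<And>s. \<xi> (s + 2 * pi) = \<xi> s" "K-lipschitz_on UNIV \<xi>" "\<And>s. \<bar>\<xi> s\<bar> \<le> B"
    "\<And>a b. a < b \<Longrightarrow> \<exists>s\<in>{a<..<b}. \<forall>\<^sub>F t in nhds s. \<xi> t = \<xi> s - (t - s)"
    by (rule periodic_zigzag) (rule that)
  then interpret zigzag \<xi> K B
    by (rule zigzag.intro)
  \<comment> \<open>The iterates start at radius 2 and never enter the region
    \<open>r \<le> 1\<close>, so an arbitrary subgradient will do there.\<close>
  define G where "G = (\<lambda>X. if cmod (xy X) > 1 then azimuthal X /\<^sub>R (cmod (xy X))\<^sup>2
    else SOME v. v \<in> clarke_subdifferential UNIV F X)"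
  have G: "G X \<in> clarke_subdifferential UNIV F X" for X
    using azimuthal_in_clarke_subdifferential[of X] F_subdifferential_nonempty[of X]
    by (simp add: G_def some_in_eq)
  have G_eq: "G X = azimuthal X /\<^sub>R (cmod (xy X))\<^sup>2" if "cmod (xy X) > 1" for X
    using that by (simp add: G_def)
  have start: "cmod (xy (2 *\<^sub>R axis 1 1)) > 1"
  proof -
    have "xy (2 *\<^sub>R axis 1 1) = 2"
      by (simp add: xy_def axis_def complex_eq_iff)
    then show ?thesis
      by simp
  qed
  show ?thesis
  proof (rule exI[of _ F], rule exI[of _ G], rule exI[of _ "2 *\<^sub>R axis 1 1"], intro conjI allI impI)
    show "\<exists>L. L-lipschitz_on UNIV F"
      using F_lipschitz by blast
    show "G X \<in> clarke_subdifferential UNIV F X" for X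
      by (rule G)
    show "bounded (range X)" if "summable (\<lambda>n. (t n)\<^sup>2)" "X 0 = 2 *\<^sub>R axis 1 1"
      "\<forall>n. X (Suc n) = X n - t n *\<^sub>R G (X n)" for t :: "nat \<Rightarrow> real" and X
      using that start by (intro azimuthal_iteration_bounded[OF G_eq]) auto
    show "x \<notin> clarke_critical UNIV F" for x
      by (simp add: F_crit_empty)
  qed
qed

end
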